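(* For every sufficiently large constant $C>0$ and every sufficiently small constant $\varepsilon>0$ there is a constant $c>0$ such that for every $n$ the following holds. Every sketch $\mathrm{sk}(A)$ for $n\times n$ positive semidefinite matrices $A$ that satisfies the ``for all'' guarantee with relative approximation $\varepsilon$ (with constant probability of success, $0.9$), even if all entries of $A$ are promised to be in the range $\{-1,-1+1/n^C,-1+2/n^C,\ldots,1-1/n^C,1\}$, must use at least $c\,n^2$ bits of space.
   Context: A sketch consists of a (possibly randomized) map $A\mapsto\mathrm{sk}(A)$ to bit strings and an estimation procedure $\mathrm{est}$ that sees only the query $x\in\mathbb R^n$ and $\mathrm{sk}(A)$ (and possibly shared random bits). It satisfies the ``for all'' guarantee with relative approximation $\varepsilon$ and success probability $p$ if for every admissible matrix $A$, with probability at least $p$, simultaneously for all $x\in\mathbb R^n$: $(1-\varepsilon)x^TAx\le\mathrm{est}(x,\mathrm{sk}(A))\le(1+\varepsilon)x^TAx$. The space is the worst-case length of $\mathrm{sk}(A)$ over all admissible $A$ and all random choices. *)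

theory Defs
  imports
    "HOL-Probability.Probability"
    "Jordan_Normal_Form.Matrix"
begin

text \<open>The dimension \<open>n\<close> is quantified inside the statement (after the constant of the
  lower bound), so matrices and vectors are those of \<open>Jordan_Normal_Form\<close>, with
  \<open>carrier_mat n n\<close> and \<open>carrier_vec n\<close> standing for the n-by-n matrices and for R^n.\<close>

definition quad_form :: "real Matrix.mat \<Rightarrow> real Matrix.vec \<Rightarrow> real" where
  "quad_form A x = scalar_prod x (mult_mat_vec A x)"

definition psd_mats :: "nat \<Rightarrow> real Matrix.mat set" where
  "psd_mats n = {A \<in> carrier_mat n n.
     transpose_mat A = A \<and> (\<forall>x \<in> carrier_vec n. 0 \<le> quad_form A x)}"

text \<open>The exponent \<open>C\<close> is real, so \<open>n powr C\<close> need not be an integer. If it is one, the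
  following set is exactly -1, -1 + 1/n^C, ..., 1 - 1/n^C, 1; otherwise the progression stops
  at its last element below 1.\<close>

definition entry_grid :: "nat \<Rightarrow> real \<Rightarrow> real set" where
  "entry_grid n C = {- 1 + real k / real n powr C | k :: nat. - 1 + real k / real n powr C \<le> 1}"

definition promised_mats :: "nat \<Rightarrow> real \<Rightarrow> real Matrix.mat set" where
  "promised_mats n C =
     {A \<in> psd_mats n. \<forall>i<n. \<forall>j<n. A $$ (i, j) \<in> entry_grid n C}"

text \<open>A random outcome is a pair: the first tape is shared by the sketching map and the
  estimator, the second is private to the sketching map. Their joint distribution is an arbitrary
  probability space; in particular either tape may be deterministic or consist of independent
  fair coins. Randomness of the estimator is part of the shared tape. The tapes have a concrete
  type because constants in a statement about sketches could otherwise depend on the type of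
  random outcomes.\<close>

type_synonym tape = "nat \<Rightarrow> bool"
type_synonym outcome = "tape \<times> tape"
type_synonym sketch_map = "real Matrix.mat \<Rightarrow> outcome \<Rightarrow> bool list"
type_synonym estimator = "real Matrix.vec \<Rightarrow> bool list \<Rightarrow> tape \<Rightarrow> real"

definition for_all_guarantee ::
  "nat \<Rightarrow> real Matrix.mat set \<Rightarrow> real \<Rightarrow> real \<Rightarrow> outcome measure \<Rightarrow>
     sketch_map \<Rightarrow> estimator \<Rightarrow> bool" where
  "for_all_guarantee n Adm \<epsilon> p M sk est \<longleftrightarrow>
     (\<forall>A \<in> Adm.
        \<P>(\<omega> in M. \<forall>x \<in> carrier_vec n.
             (1 - \<epsilon>) * quad_form A x \<le> est x (sk A \<omega>) (fst \<omega>) \<and>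
             est x (sk A \<omega>) (fst \<omega>) \<le> (1 + \<epsilon>) * quad_form A x) \<ge> p)"

definition sketch_space ::
  "real Matrix.mat set \<Rightarrow> outcome measure \<Rightarrow> sketch_map \<Rightarrow> enat" where
  "sketch_space Adm M sk = (SUP A \<in> Adm. SUP \<omega> \<in> space M. enat (length (sk A \<omega>)))"

end

theory Submission
  imports Defs
begin

text \<open>The random outcome can be fixed so that nine tenths of a finite family are sketched
  correctly at once. If any two members are told apart by a vector at which exactly one of the two
  forms vanishes, these sketches are pairwise distinct whatever \<open>\<epsilon> < 1\<close> is, so the space is about the
  logarithm of the size of the family.

  For the family, let \<open>G\<close> be the block matrix \<open>(I | S | 0)\<close> with a zero-one matrix \<open>S\<close> of size
  \<open>k = (n - 1) div 2\<close>. The kernel of \<open>G\<close> determines \<open>S\<close>, and there are \<open>2 ^ k\<^sup>2\<close> choices. The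
  matrices \<open>G\<^sup>T G / n\<^sup>C\<close> have entries in the grid if \<open>n\<^sup>C\<close> is an integer. In general the grid does not
  contain 0; adding \<open>(\<lceil>n\<^sup>C\<rceil> - n\<^sup>C) / n\<^sup>C\<close> to every entry moves them back to the grid, and this rank-one
  perturbation is invisible on vectors with coordinate sum 0. The zero column of \<open>G\<close> leaves a free
  coordinate with which the kernel vectors are given that sum.\<close>

section \<open>Counting sketches\<close>

definition separated :: "nat \<Rightarrow> real Matrix.mat \<Rightarrow> real Matrix.mat \<Rightarrow> bool" where
  "separated n A B \<longleftrightarrow> (\<exists>x \<in> carrier_vec n.
     quad_form A x = 0 \<and> 0 < quad_form B x \<or> quad_form B x = 0 \<and> 0 < quad_form A x)"

text \<open>A relative error bound forces the estimate to be exactly 0 where one form vanishes, and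
  at least \<open>1 - \<epsilon>\<close> times a positive number for the other form.\<close>

lemma separated_no_common_estimate:
  assumes "separated n A B" and "\<epsilon> < 1"
    and "\<forall>x \<in> carrier_vec n. (1 - \<epsilon>) * quad_form A x \<le> e x \<and> e x \<le> (1 + \<epsilon>) * quad_form A x"
    and "\<forall>x \<in> carrier_vec n. (1 - \<epsilon>) * quad_form B x \<le> e x \<and> e x \<le> (1 + \<epsilon>) * quad_form B x"
  shows False
proof -
  obtain x where x: "x \<in> carrier_vec n"
    "quad_form A x = 0 \<and> 0 < quad_form B x \<or> quad_form B x = 0 \<and> 0 < quad_form A x"
    using assms(1) unfolding separated_def by blast
  have "0 < (1 - \<epsilon>) * q" if "0 < q" for q
    using that assms(2) by simp
  then show False
    using x assms(3,4) by fastforce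
qed

lemma card_bool_lists_length_le: "card {xs :: bool list. length xs \<le> L} = 2 ^ (L + 1) - 1"
proof -
  have "(\<Sum>i\<le>L. (2::nat) ^ i) = 2 ^ (L + 1) - 1"
    by (induction L) auto
  then show ?thesis
    using card_lists_length_le[of "UNIV :: bool set" L] by simp
qed

lemma finite_bool_lists_length_le: "finite {xs :: bool list. length xs \<le> L}"
  using finite_lists_length_le[of "UNIV :: bool set" L] by simp

text \<open>Double counting: the expected number of accurately sketched members of \<open>F\<close>
  is at least \<open>p * card F\<close>, while for each fixed outcome these members have distinct
  sketches among the lists of length at most \<open>L\<close>.\<close>

lemma separated_family_card_le:
  assumes "prob_space M" and guarantee: "for_all_guarantee n Adm \<epsilon> p M sk est"
    and "0 < p" and "\<epsilon> < 1" and "finite F" and "F \<subseteq> Adm"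
    and sep: "\<And>A B. A \<in> F \<Longrightarrow> B \<in> F \<Longrightarrow> A \<noteq> B \<Longrightarrow> separated n A B"
    and len: "\<And>A \<omega>. A \<in> Adm \<Longrightarrow> \<omega> \<in> space M \<Longrightarrow> length (sk A \<omega>) \<le> L"
  shows "p * real (card F) \<le> 2 ^ (L + 1) - 1"
proof -
  interpret prob_space M by fact
  define accurate where "accurate A \<omega> \<longleftrightarrow> (\<forall>x \<in> carrier_vec n.
      (1 - \<epsilon>) * quad_form A x \<le> est x (sk A \<omega>) (fst \<omega>) \<and>
      est x (sk A \<omega>) (fst \<omega>) \<le> (1 + \<epsilon>) * quad_form A x)" for A \<omega>
  define good where "good A = {\<omega> \<in> space M. accurate A \<omega>}" for A
  have p_le: "p \<le> prob (good A)" if "A \<in> F" for A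
    using guarantee that \<open>F \<subseteq> Adm\<close>
    unfolding for_all_guarantee_def good_def accurate_def by blast
  \<comment> \<open>\<open>prob\<close> is 0 on sets outside the sigma-algebra, so the positive
    lower bound \<open>p\<close> forces measurability.\<close>
  have meas: "good A \<in> events" if "A \<in> F" for A
    using p_le[OF that] \<open>0 < p\<close> measure_notin_sets[of "good A" M] by fastforce
  have few: "(\<Sum>A\<in>F. indicat_real (good A) \<omega>) \<le> 2 ^ (L + 1) - 1" if "\<omega> \<in> space M" for \<omega>
  proof -
    let ?H = "{A \<in> F. \<omega> \<in> good A}"
    \<comment> \<open>Both sketches are read with the same shared tape \<open>fst \<omega>\<close>,
      so equal sketches give one estimate function that is accurate for both matrices.\<close>
    have inj: "inj_on (\<lambda>A. sk A \<omega>) ?H"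
    proof (intro inj_onI)
      fix A B
      assume A: "A \<in> ?H" and B: "B \<in> ?H" and eq: "sk A \<omega> = sk B \<omega>"
      show "A = B"
      proof (rule ccontr)
        assume "A \<noteq> B"
        then have "separated n A B"
          using A B sep by blast
        then show False
          using separated_no_common_estimate[of n A B \<epsilon> "\<lambda>x. est x (sk A \<omega>) (fst \<omega>)"]
            A B eq \<open>\<epsilon> < 1\<close> unfolding good_def accurate_def by simp
      qed
    qed
    have "(\<lambda>A. sk A \<omega>) ` ?H \<subseteq> {xs. length xs \<le> L}"
      using len that \<open>F \<subseteq> Adm\<close> by blast
    then have "card ?H \<le> 2 ^ (L + 1) - 1"
      using card_inj_on_le[OF inj _ finite_bool_lists_length_le]
      by (simp only: card_bool_lists_length_le)
    then have "real (card ?H) \<le> real (2 ^ (L + 1) - 1)"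
      by (simp only: of_nat_le_iff)
    moreover have "(\<Sum>A\<in>F. indicat_real (good A) \<omega>) = real (card ?H)"
      using \<open>finite F\<close> by (simp add: indicator_def of_bool_def sum.If_cases Int_def)
    ultimately show ?thesis
      by (simp add: of_nat_diff)
  qed
  have "p * real (card F) \<le> (\<Sum>A\<in>F. prob (good A))"
    using sum_mono[of F "\<lambda>_. p", OF p_le] by (simp add: mult.commute)
  also have "\<dots> = expectation (\<lambda>\<omega>. \<Sum>A\<in>F. indicat_real (good A) \<omega>)"
    using meas by (subst Bochner_Integration.integral_sum) (auto simp: emeasure_finite less_top[symmetric])
  also have "\<dots> \<le> 2 ^ (L + 1) - 1"
  proof (rule integral_le_const)
    show "integrable M (\<lambda>\<omega>. \<Sum>A\<in>F. indicat_real (good A) \<omega>)"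
      using meas by (auto simp: emeasure_finite less_top[symmetric])
  qed (use few in auto)
  finally show ?thesis .
qed

lemma sketch_space_ge:
  assumes "prob_space M" and "for_all_guarantee n Adm \<epsilon> (9 / 10) M sk est"
    and "\<epsilon> < 1" and "finite F" and "F \<subseteq> Adm"
    and "\<And>A B. A \<in> F \<Longrightarrow> B \<in> F \<Longrightarrow> A \<noteq> B \<Longrightarrow> separated n A B"
    and card: "card F = 2 ^ K" and "1 \<le> K"
  shows "ereal (real K / 2) \<le> ereal_of_enat (sketch_space Adm M sk)"
proof (cases "sketch_space Adm M sk")
  case (enat L)
  have "length (sk A \<omega>) \<le> L" if "A \<in> Adm" "\<omega> \<in> space M" for A \<omega>
  proof -
    have "enat (length (sk A \<omega>)) \<le> (SUP \<omega> \<in> space M. enat (length (sk A \<omega>)))"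
      using that by (intro SUP_upper)
    also have "\<dots> \<le> sketch_space Adm M sk"
      unfolding sketch_space_def using that by (intro SUP_upper)
    finally show ?thesis
      by (simp add: enat)
  qed
  then have le: "9 / 10 * real (2 ^ K) \<le> 2 ^ (L + 1) - 1"
    using separated_family_card_le[OF assms(1,2) _ assms(3-6), of L] by (simp add: card)
  have "K \<le> 2 * L"
  proof (rule ccontr)
    assume K: "\<not> K \<le> 2 * L"
    show False
    proof (cases "L = 0")
      \<comment> \<open>Only \<open>K \<ge> 1\<close> is known here, so the exact count matters:
        there is one empty list, and 9/10 of 2 exceeds 1.\<close>
      case True
      have "(2::real) ^ 1 \<le> 2 ^ K"
        using \<open>1 \<le> K\<close> by (intro power_increasing) auto
      then show False
        using le True by simp
    next
      case False
      \<comment> \<open>For \<open>L \<ge> 1\<close>, \<open>K \<ge> 2 * L + 1\<close> gives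
        \<open>K \<ge> L + 2\<close>; the spare factor 2 absorbs the loss of one tenth.\<close>
      then have "(2::real) ^ (L + 2) \<le> 2 ^ K"
        using K by (intro power_increasing) auto
      then have "4 * (2::real) ^ L \<le> 2 ^ K"
        by simp
      moreover have "9 / 10 * (2::real) ^ K \<le> 2 * 2 ^ L - 1"
        using le by simp
      ultimately show False
        using zero_less_power[of "2::real" L] by linarith
    qed
  qed
  then show ?thesis
    by (simp add: enat)
qed simp

section \<open>Shifted Gram matrices\<close>

text \<open>With \<open>G\<close> the zero-one matrix of \<open>g\<close> and \<open>J\<close> the
  all-ones matrix, this is (G^T G + \<theta> J) / N.\<close>

definition shifted_gram :: "real \<Rightarrow> real \<Rightarrow> nat \<Rightarrow> nat \<Rightarrow> (nat \<Rightarrow> nat \<Rightarrow> bool) \<Rightarrow> real Matrix.mat" where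
  "shifted_gram \<theta> N m n g = Matrix.mat n n (\<lambda>(i, j).
     (\<theta> + (\<Sum>r<m. of_bool (g r i) * of_bool (g r j))) / N)"

lemma quad_form_shifted_gram:
  fixes x :: "real Matrix.vec"
  assumes "x \<in> carrier_vec n"
  shows "quad_form (shifted_gram \<theta> N m n g) x =
    (\<theta> * (\<Sum>i<n. x $ i)\<^sup>2 + (\<Sum>r<m. (\<Sum>i<n. of_bool (g r i) * x $ i)\<^sup>2)) / N"
proof -
  define a :: "nat \<Rightarrow> nat \<Rightarrow> real" where "a r i = of_bool (g r i)" for r i
  have "quad_form (shifted_gram \<theta> N m n g) x =
      (\<Sum>i<n. x $ i * (\<Sum>j<n. (\<theta> + (\<Sum>r<m. a r i * a r j)) / N * x $ j))"
    using assms unfolding quad_form_def shifted_gram_def a_def[symmetric]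
    by (auto simp: scalar_prod_def lessThan_atLeast0 intro!: sum.cong)
  also have "\<dots> = (\<Sum>i<n. \<Sum>j<n. \<theta> * (x $ i * x $ j) / N +
      (\<Sum>r<m. (a r i * x $ i) * (a r j * x $ j)) / N)"
    by (simp add: sum_distrib_left sum_distrib_right distrib_right distrib_left
        add_divide_distrib sum_divide_distrib mult_ac)
  also have "\<dots> = (\<theta> * (\<Sum>i<n. \<Sum>j<n. x $ i * x $ j) +
      (\<Sum>i<n. \<Sum>j<n. \<Sum>r<m. (a r i * x $ i) * (a r j * x $ j))) / N"
    by (simp add: sum.distrib sum_distrib_left sum_divide_distrib add_divide_distrib)
  also have "(\<Sum>i<n. \<Sum>j<n. \<Sum>r<m. (a r i * x $ i) * (a r j * x $ j)) =
      (\<Sum>r<m. \<Sum>i<n. \<Sum>j<n. (a r i * x $ i) * (a r j * x $ j))"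
    by (simp only: sum.swap[where A = "{..<n}" and B = "{..<m}"])
  finally show ?thesis
    by (simp only: power2_eq_square sum_product a_def)
qed

lemma shifted_gram_psd:
  assumes "0 \<le> \<theta>" and "0 < N"
  shows "shifted_gram \<theta> N m n g \<in> psd_mats n"
proof -
  have "transpose_mat (shifted_gram \<theta> N m n g) = shifted_gram \<theta> N m n g"
    unfolding shifted_gram_def by (intro eq_matI)
      (auto simp: mult.commute simp del: sum_mult_of_bool_eq sum_of_bool_mult_eq)
  moreover have "0 \<le> quad_form (shifted_gram \<theta> N m n g) x" if "x \<in> carrier_vec n" for x
    unfolding quad_form_shifted_gram[OF that] using assms
    by (intro divide_nonneg_pos add_nonneg_nonneg mult_nonneg_nonneg sum_nonneg) auto
  ultimately show ?thesis
    unfolding psd_mats_def by (auto simp: shifted_gram_def)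
qed

text \<open>Since \<open>\<theta> + N\<close> is the integer ceiling of \<open>N\<close>, every
  entry exceeds -1 by an integer multiple of \<open>1 / N\<close>; the bound on \<open>m\<close>
  keeps it at most 1.\<close>

lemma shifted_gram_promised:
  fixes n :: nat and C :: real
  defines "N \<equiv> real n powr C"
  defines "\<theta> \<equiv> of_int \<lceil>N\<rceil> - N"
  assumes "0 < n" and "\<theta> + real m \<le> N"
  shows "shifted_gram \<theta> N m n g \<in> promised_mats n C"
proof -
  have N: "0 < N"
    using \<open>0 < n\<close> by (simp add: N_def)
  have \<theta>: "0 \<le> \<theta>"
    by (simp add: \<theta>_def)
  have "shifted_gram \<theta> N m n g $$ (i, j) \<in> entry_grid n C" if "i < n" "j < n" for i j
  proof -
    define t :: nat where "t = (\<Sum>r<m. of_bool (g r i) * of_bool (g r j))"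
    have "t \<le> (\<Sum>r<m. 1)"
      unfolding t_def by (intro sum_mono) auto
    then have "t \<le> m"
      by simp
    have "\<theta> = real (nat \<lceil>N\<rceil>) - N"
      using N by (simp add: \<theta>_def)
    then have eq: "(\<theta> + real t) / N = - 1 + real (nat \<lceil>N\<rceil> + t) / N"
      using N by (simp add: field_simps)
    moreover have "(\<theta> + real t) / N \<le> 1"
      using N \<open>t \<le> m\<close> assms(4) by simp
    ultimately have "(\<theta> + real t) / N \<in> entry_grid n C"
      unfolding entry_grid_def N_def[symmetric] by (metis (mono_tags, lifting) mem_Collect_eq)
    then show ?thesis
      using that by (simp add: shifted_gram_def t_def)
  qed
  then show ?thesis
    using shifted_gram_psd[OF \<theta> N] unfolding promised_mats_def by blast
qed

text \<open>The shift vanishes as a product: either the coordinates of \<open>x\<close> sum to 0, or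
  \<open>\<theta> = 0\<close>, which covers dimension 1, where no nonzero vector has sum 0.\<close>

lemma shifted_gram_separated:
  fixes x :: "real Matrix.vec"
  assumes "0 < N" and "0 \<le> \<theta>" and x: "x \<in> carrier_vec n" and "\<theta> * (\<Sum>i<n. x $ i)\<^sup>2 = 0"
    and "\<And>r. r < m \<Longrightarrow> (\<Sum>i<n. of_bool (g r i) * x $ i) = 0"
    and "r < m" and "(\<Sum>i<n. of_bool (h r i) * x $ i) \<noteq> 0"
  shows "separated n (shifted_gram \<theta> N m n g) (shifted_gram \<theta> N m n h)"
proof -
  have "0 < (\<Sum>r<m. (\<Sum>i<n. of_bool (h r i) * x $ i)\<^sup>2)"
    by (rule sum_pos2[of _ r]) (use assms(6,7) in auto)
  then have "0 < quad_form (shifted_gram \<theta> N m n h) x"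
    unfolding quad_form_shifted_gram[OF x] assms(4) using \<open>0 < N\<close>
    by (simp only: add_0_left divide_pos_pos)
  moreover have "(\<Sum>r<m. (\<Sum>i<n. of_bool (g r i) * x $ i)\<^sup>2) = 0"
    using assms(5) by (intro sum.neutral) simp
  then have "quad_form (shifted_gram \<theta> N m n g) x = 0"
    unfolding quad_form_shifted_gram[OF x] assms(4) by (simp only: add_0_left div_0)
  ultimately show ?thesis
    unfolding separated_def using x by blast
qed

section \<open>Block matrices and their kernels\<close>

definition block_pattern :: "nat \<Rightarrow> (nat \<times> nat) set \<Rightarrow> nat \<Rightarrow> nat \<Rightarrow> bool" where
  "block_pattern k S r i \<longleftrightarrow> i = r \<or> k \<le> i \<and> i < 2 * k \<and> (r, i - k) \<in> S"

text \<open>In blocks this is (-S e_c, e_c, s), a kernel vector of (I | S | 0). The entry at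
  \<open>2 * k\<close> meets a zero column and is chosen to make the coordinate sum 0.\<close>

definition kernel_vec :: "nat \<Rightarrow> nat \<Rightarrow> (nat \<times> nat) set \<Rightarrow> nat \<Rightarrow> real Matrix.vec" where
  "kernel_vec n k S c = Matrix.vec n (\<lambda>i.
     if i < k then - of_bool ((i, c) \<in> S)
     else if i = k + c then 1
     else if i = 2 * k then (\<Sum>r<k. of_bool ((r, c) \<in> S)) - 1
     else 0)"

lemma kernel_vec_carrier: "kernel_vec n k S c \<in> carrier_vec n"
  by (simp add: kernel_vec_def)

lemma sum_lessThan_eq_three_parts:
  fixes f :: "nat \<Rightarrow> real"
  assumes "2 * k < n" and "c < k"
    and "\<And>i. k \<le> i \<Longrightarrow> i < n \<Longrightarrow> i \<noteq> k + c \<Longrightarrow> i \<noteq> 2 * k \<Longrightarrow> f i = 0"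
  shows "sum f {..<n} = sum f {..<k} + f (k + c) + f (2 * k)"
proof -
  have "sum f {..<n} = sum f ({..<k} \<union> {k + c, 2 * k})"
    using assms by (intro sum.mono_neutral_right) auto
  also have "\<dots> = sum f {..<k} + sum f {k + c, 2 * k}"
    by (intro sum.union_disjoint) auto
  finally show ?thesis
    using \<open>c < k\<close> by simp
qed

lemma sum_kernel_vec:
  assumes "2 * k < n" and "c < k"
  shows "(\<Sum>i<n. kernel_vec n k S c $ i) = 0"
  using assms by (subst sum_lessThan_eq_three_parts[OF assms]) (auto simp: kernel_vec_def sum_negf)

text \<open>This is row \<open>r\<close> of (T - S) e_c: it is zero for \<open>T = S\<close>, and
  nonzero exactly where column \<open>c\<close> of the two matrices differs.\<close>

lemma block_pattern_mult_kernel_vec: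
  assumes "2 * k < n" and "c < k" and "r < k"
  shows "(\<Sum>i<n. of_bool (block_pattern k T r i) * kernel_vec n k S c $ i) =
    of_bool ((r, c) \<in> T) - of_bool ((r, c) \<in> S)"
proof -
  have "(\<Sum>i<k. of_bool (block_pattern k T r i) * kernel_vec n k S c $ i) =
      (\<Sum>i<k. if i = r then kernel_vec n k S c $ i else 0)"
    by (intro sum.cong) (auto simp: block_pattern_def)
  also have "\<dots> = - of_bool ((r, c) \<in> S)"
    using assms by (simp add: kernel_vec_def)
  finally show ?thesis
    using assms
    by (subst sum_lessThan_eq_three_parts[OF assms(1,2)])
      (auto simp: kernel_vec_def block_pattern_def)
qed

lemma block_family_separated:
  assumes "0 < N" and "0 \<le> \<theta>" and "2 * k < n"
    and "S \<subseteq> {..<k} \<times> {..<k}" and "T \<subseteq> {..<k} \<times> {..<k}" and "S \<noteq> T"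
  shows "separated n (shifted_gram \<theta> N k n (block_pattern k S))
    (shifted_gram \<theta> N k n (block_pattern k T))"
proof -
  \<comment> \<open>The column of a differing position selects the kernel vector of
    \<open>S\<close>, and its row is where the product with the matrix of \<open>T\<close> is
    nonzero.\<close>
  obtain r c where rc: "r < k" "c < k" "(r, c) \<in> S \<longleftrightarrow> (r, c) \<notin> T"
    using assms(4-6) by blast
  show ?thesis
    using assms(1-3) rc
    by (intro shifted_gram_separated[where x = "kernel_vec n k S c" and r = r])
      (auto simp: kernel_vec_carrier sum_kernel_vec block_pattern_mult_kernel_vec
        simp del: sum_mult_of_bool_eq sum_of_bool_mult_eq)
qed

section \<open>Space bounds in large and small dimensions\<close>

lemma separated_irrefl: "\<not> separated n A A"
  by (auto simp: separated_def)

lemma sketch_space_ge_block: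
  fixes C :: real
  assumes "prob_space M" and "for_all_guarantee n (promised_mats n C) \<epsilon> (9 / 10) M sk est"
    and "\<epsilon> < 1" and "2 \<le> C" and "1 \<le> k" and k: "2 * k < n"
  shows "ereal (real (k * k) / 2) \<le> ereal_of_enat (sketch_space (promised_mats n C) M sk)"
proof -
  define N where "N = real n powr C"
  define \<theta> where "\<theta> = of_int \<lceil>N\<rceil> - N"
  define A where "A S = shifted_gram \<theta> N k n (block_pattern k S)" for S
  let ?P = "Pow ({..<k} \<times> {..<k})"
  have N: "0 < N" and \<theta>: "0 \<le> \<theta>"
    using k by (simp_all add: N_def \<theta>_def)
  \<comment> \<open>The entries fit under 1 because \<open>n \<ge> 3\<close> and
    \<open>C \<ge> 2\<close> give n^C \<ge> n^2 \<ge> n + 1, which is at least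
    \<open>\<theta> + k\<close>.\<close>
  have "real n powr 2 \<le> N"
    unfolding N_def using k \<open>2 \<le> C\<close> by (intro powr_mono) auto
  moreover have "1 * n + 1 \<le> n * n"
    using mult_le_mono1[of 2 n n] k \<open>1 \<le> k\<close> by linarith
  then have "real n + 1 \<le> real n * real n"
    by (metis mult_1 of_nat_1 of_nat_add of_nat_le_iff of_nat_mult)
  ultimately have "real n + 1 \<le> N"
    using k by (simp add: power2_eq_square)
  moreover have "\<theta> \<le> 1"
    unfolding \<theta>_def by linarith
  ultimately have "\<theta> + real k \<le> N"
    using k by linarith
  then have promised: "A S \<in> promised_mats n C" for S
    unfolding A_def \<theta>_def N_def using k by (intro shifted_gram_promised) auto
  have sep: "separated n (A S) (A T)" if "S \<in> ?P" "T \<in> ?P" "S \<noteq> T" for S T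
    unfolding A_def using that by (intro block_family_separated[OF N \<theta> k]) auto
  then have "inj_on A ?P"
    by (metis inj_onI separated_irrefl)
  then have card: "card (A ` ?P) = 2 ^ (k * k)"
    by (simp add: card_image card_Pow card_cartesian_product)
  show ?thesis
    by (rule sketch_space_ge[OF assms(1-3), of "A ` ?P"])
      (use promised sep card \<open>1 \<le> k\<close> in auto)
qed

text \<open>No block size \<open>k \<ge> 1\<close> satisfies \<open>2 * k < n\<close> here, but the
  bound must still be positive; two separated matrices supply it.\<close>

lemma sketch_space_ge_half:
  fixes C :: real
  assumes "prob_space M" and "for_all_guarantee n (promised_mats n C) \<epsilon> (9 / 10) M sk est"
    and "\<epsilon> < 1" and "2 \<le> C" and "0 < n" and "n \<le> 2"
  shows "ereal (1 / 2) \<le> ereal_of_enat (sketch_space (promised_mats n C) M sk)"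
proof -
  define N where "N = real n powr C"
  define \<theta> where "\<theta> = of_int \<lceil>N\<rceil> - N"
  define A where "A = shifted_gram \<theta> N 1 n (\<lambda>_ _. False)"
  define B where "B = shifted_gram \<theta> N 1 n (\<lambda>_ i. i = 0)"
  define x :: "real Matrix.vec" where "x = Matrix.vec n (\<lambda>i. if i = 0 then 1 else - 1)"
  have N: "0 < N" and \<theta>: "0 \<le> \<theta>"
    using \<open>0 < n\<close> by (simp_all add: N_def \<theta>_def)
  consider "n = 1" | "n = 2"
    using \<open>0 < n\<close> \<open>n \<le> 2\<close> by linarith
  \<comment> \<open>For \<open>n = 1\<close> the grid scale is \<open>N = 1\<close>, so
    \<open>\<theta> = 0\<close>; for \<open>n = 2\<close> the vector is (1, -1), and
    \<open>N \<ge> 4\<close> leaves room for the entries.\<close>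
  then have "\<theta> + real 1 \<le> N \<and> \<theta> * (\<Sum>i<n. x $ i)\<^sup>2 = 0"
  proof cases
    case 1
    then show ?thesis
      by (simp add: \<theta>_def N_def)
  next
    case 2
    have "(2::real) powr 2 \<le> 2 powr C"
      using \<open>2 \<le> C\<close> by (intro powr_mono) auto
    moreover have "\<theta> \<le> 1"
      unfolding \<theta>_def by linarith
    ultimately show ?thesis
      using 2 by (simp add: N_def x_def numeral_2_eq_2)
  qed
  then have small: "\<theta> + real 1 \<le> N" and shift: "\<theta> * (\<Sum>i<n. x $ i)\<^sup>2 = 0"
    by auto
  have "A \<in> promised_mats n C" "B \<in> promised_mats n C"
    using small \<open>0 < n\<close> unfolding A_def B_def \<theta>_def N_def
    by (auto intro!: shifted_gram_promised)
  moreover have "(\<Sum>i<n. of_bool (i = 0) * x $ i) = (\<Sum>i<n. if i = 0 then x $ i else 0)"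
    by (intro sum.cong) auto
  then have "(\<Sum>i<n. of_bool (i = 0) * x $ i) = 1"
    using \<open>0 < n\<close> by (simp add: x_def)
  then have sep: "separated n A B"
    unfolding A_def B_def using shift
    by (intro shifted_gram_separated[OF N \<theta>, where x = x and r = 0]) (auto simp: x_def)
  moreover have "separated n B A"
    using sep unfolding separated_def by blast
  moreover have "card {A, B} = 2 ^ 1"
    using sep separated_irrefl by (metis card_2_iff power_one_right)
  ultimately have "ereal (real 1 / 2) \<le> ereal_of_enat (sketch_space (promised_mats n C) M sk)"
    by (intro sketch_space_ge[OF assms(1-3), of "{A, B}"]) auto
  then show ?thesis
    by simp
qed

theorem theorem5p1:
  shows "\<exists>C\<^sub>0 > (0::real). \<exists>\<epsilon>\<^sub>0 > (0::real).
    \<forall>C \<ge> C\<^sub>0. \<forall>\<epsilon>. 0 < \<epsilon> \<and> \<epsilon> \<le> \<epsilon>\<^sub>0 \<longrightarrow>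
      (\<exists>c > (0::real). \<forall>n. \<forall>M sk est.
         prob_space M \<and> for_all_guarantee n (promised_mats n C) \<epsilon> (9 / 10) M sk est \<longrightarrow>
         ereal (c * (real n)\<^sup>2) \<le> ereal_of_enat (sketch_space (promised_mats n C) M sk))"
proof -
  \<comment> \<open>For \<open>n \<ge> 3\<close> the inequality \<open>n \<le> 4 * k\<close> turns
    k^2 / 2 into n^2 / 32; for \<open>n \<le> 2\<close> the value n^2 / 32 is at most 1/8.\<close>
  have bound: "ereal (1 / 32 * (real n)\<^sup>2) \<le> ereal_of_enat (sketch_space (promised_mats n C) M sk)"
    if "2 \<le> C" and "\<epsilon> \<le> 1 / 2" and "prob_space M"
      and "for_all_guarantee n (promised_mats n C) \<epsilon> (9 / 10) M sk est"
    for C \<epsilon> :: real and n M sk est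
  proof -
    have "\<epsilon> < 1"
      using that by simp
    consider "n = 0" | "0 < n" "n \<le> 2" | "3 \<le> n"
      by linarith
    then show ?thesis
    proof cases
      case 1
      then show ?thesis
        by (simp add: zero_ereal_def[symmetric])
    next
      case 2
      then have "(real n)\<^sup>2 \<le> 2\<^sup>2"
        by (intro power_mono) auto
      then have "ereal (1 / 32 * (real n)\<^sup>2) \<le> ereal (1 / 2)"
        by simp
      also have "\<dots> \<le> ereal_of_enat (sketch_space (promised_mats n C) M sk)"
        by (rule sketch_space_ge_half[OF that(3,4) \<open>\<epsilon> < 1\<close> that(1) 2])
      finally show ?thesis .
    next
      case 3
      \<comment> \<open>The largest \<open>k\<close> with \<open>2 * k < n\<close>. Then
        \<open>n \<le> 2 * k + 2\<close>, which is at most \<open>4 * k\<close> as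
        \<open>k \<ge> 1\<close>.\<close>
      define k where "k = (n - 1) div 2"
      have k: "1 \<le> k" "2 * k < n" "n \<le> 4 * k"
        unfolding k_def using 3 by presburger+
      have "(real n)\<^sup>2 \<le> (4 * real k)\<^sup>2"
        using k by (intro power_mono) auto
      then have "ereal (1 / 32 * (real n)\<^sup>2) \<le> ereal (real (k * k) / 2)"
        by (simp add: power2_eq_square)
      also have "\<dots> \<le> ereal_of_enat (sketch_space (promised_mats n C) M sk)"
        by (rule sketch_space_ge_block[OF that(3,4) \<open>\<epsilon> < 1\<close> that(1) k(1,2)])
      finally show ?thesis .
    qed
  qed
  show ?thesis
    by (intro exI[of _ "2::real"] exI[of _ "1 / 2 :: real"] conjI allI impI exI[of _ "1 / 32 :: real"])
      (use bound in auto)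
qed

end
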